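(* (Primitive Decomposition.) Let $A$ be an integer weighing matrix, i.e. $A\in\mathbb Z^{n\times n}$ with $AA^\top=kI$ for some integer $k$. Then $A$ is H-equivalent to a block diagonal sum $A_1\oplus\cdots\oplus A_r$ of primitive integer weighing matrices. This decomposition is unique in the following sense: if $A_1\oplus\cdots\oplus A_r\sim_H A'_1\oplus\cdots\oplus A'_s$ with all $A_i,A'_j$ primitive integer weighing matrices, then $r=s$ and there is a permutation $\pi\in S_r$ such that $A_i\sim_H A'_{\pi(i)}$ for all $i$.
   Context: $\mathrm{Mon}(n)$ denotes the set of $n\times n$ monomial matrices with entries in $\{0,1,-1\}$ (exactly one nonzero entry in each row and column). Two integer matrices $A,B$ of the same size $m\times n$ are H-equivalent, written $A\sim_H B$, if $B=LAR^\top$ for some $L\in\mathrm{Mon}(m)$, $R\in\mathrm{Mon}(n)$ (equivalently, $B$ is obtained from $A$ by permuting and negating rows and columns). $X\oplus Y$ denotes the block diagonal sum of square matrices. An integer weighing matrix $A$ is primitive if it is not H-equivalent to a block diagonal sum of two or more smaller square blocks. *)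

theory Defs
  imports "Jordan_Normal_Form.Matrix" "HOL-Combinatorics.Permutations"
begin

definition Mon :: "nat \<Rightarrow> int mat set" where
  "Mon n = {M \<in> carrier_mat n n.
     (\<forall>i<n. \<forall>j<n. M $$ (i,j) \<in> {0, 1, -1}) \<and>
     (\<forall>i<n. \<exists>!j. j < n \<and> M $$ (i,j) \<noteq> 0) \<and>
     (\<forall>j<n. \<exists>!i. i < n \<and> M $$ (i,j) \<noteq> 0)}"

definition H_equiv :: "int mat \<Rightarrow> int mat \<Rightarrow> bool" (infix \<open>\<sim>\<^sub>H\<close> 50) where
  "A \<sim>\<^sub>H B \<longleftrightarrow>
     (\<exists>L \<in> Mon (dim_row A). \<exists>R \<in> Mon (dim_col A). B = L * A * transpose_mat R)"

definition integer_weighing :: "int mat \<Rightarrow> bool" where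
  "integer_weighing A \<longleftrightarrow>
     square_mat A \<and> (\<exists>k. A * transpose_mat A = k \<cdot>\<^sub>m 1\<^sub>m (dim_row A))"

text \<open>Matrices here may have size \<open>0 \<times> 0\<close>, the neutral element of the block diagonal
  sum. It must not count as primitive, since otherwise decompositions would not be unique;
  it is the sum of the empty list of blocks.\<close>

definition primitive_weighing :: "int mat \<Rightarrow> bool" where
  "primitive_weighing A \<longleftrightarrow>
     integer_weighing A \<and> 0 < dim_row A \<and>
     \<not> (\<exists>Bs. 2 \<le> length Bs \<and>
            (\<forall>B \<in> set Bs. square_mat B \<and> 0 < dim_row B \<and> dim_row B < dim_row A) \<and>
            A \<sim>\<^sub>H diag_block_mat Bs)"

end

theory Submission
  imports Defs "Jordan_Normal_Form.Determinant"
begin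

text \<open>Existence is induction on the size. For uniqueness, call two rows adjacent if they have
  nonzero entries in a common column. A primitive matrix is connected under this relation: either
  it is the \<open>1 \<times> 1\<close> zero matrix, or its determinant is nonzero, and then a union of connected
  components has as many rows as it has nonzero columns, so it could be split off as a square
  block. Hence the blocks of a sum of primitive matrices are recovered from the row components,
  which every H-equivalence preserves. Working with rows alone treats zero blocks correctly: an
  H-equivalence may permute the zero columns independently of the zero rows.\<close>

section \<open>H-equivalence in terms of entries\<close>

text \<open>Uniqueness along rows makes \<open>p\<close> a function, uniqueness along columns makes
  it injective, and an injective self-map of a finite set is bijective.\<close>

lemma Mon_entries:
  assumes "L \<in> Mon n"
  obtains p s where "bij_betw p {..<n} {..<n}" "\<And>i. s i \<in> {1, -1 :: int}"
    "\<And>i j. i < n \<Longrightarrow> j < n \<Longrightarrow> L $$ (i,j) = (if j = p i then s i else 0)"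
proof -
  define p where "p i = (THE j. j < n \<and> L $$ (i,j) \<noteq> 0)" for i
  \<comment> \<open>The default value 1 lets the sign condition hold for every index, so later uses
    need no range check.\<close>
  define s where "s i = (if i < n then L $$ (i, p i) else 1)" for i
  have row: "\<exists>!j. j < n \<and> L $$ (i,j) \<noteq> 0" if "i < n" for i
    using assms that by (auto simp: Mon_def)
  have col: "\<exists>!i. i < n \<and> L $$ (i,j) \<noteq> 0" if "j < n" for j
    using assms that by (auto simp: Mon_def)
  have p: "p i < n \<and> L $$ (i, p i) \<noteq> 0" if "i < n" for i
    unfolding p_def by (rule theI'[OF row[OF that]])
  have puniq: "j = p i" if "i < n" "j < n" "L $$ (i,j) \<noteq> 0" for i j
    using row[OF that(1)] p[OF that(1)] that by blast
  have "inj_on p {..<n}"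
  proof (rule inj_onI)
    fix x y assume "x \<in> {..<n}" "y \<in> {..<n}" "p x = p y"
    then show "x = y" using p[of x] p[of y] col[of "p x"] by auto
  qed
  moreover have "p ` {..<n} \<subseteq> {..<n}" using p by auto
  ultimately have "bij_betw p {..<n} {..<n}"
    unfolding bij_betw_def using endo_inj_surj[of "{..<n}" p] by auto
  moreover have "s i \<in> {1, -1}" for i
    using assms p[of i] by (auto simp: Mon_def s_def)
  moreover have "L $$ (i,j) = (if j = p i then s i else 0)" if "i < n" "j < n" for i j
    using that puniq by (auto simp: s_def)
  ultimately show ?thesis using that by blast
qed

lemma mat_in_Mon:
  assumes p: "bij_betw p {..<n} {..<n}" and s: "\<And>i. s i \<in> {1, -1 :: int}"
  shows "mat n n (\<lambda>(i,j). if j = p i then s i else 0) \<in> Mon n"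
proof -
  have nz: "s i \<noteq> 0" for i using s[of i] by auto
  have pn: "p i < n" if "i < n" for i using p that by (auto dest: bij_betwE)
  have "\<exists>!j. j < n \<and> mat n n (\<lambda>(i,j). if j = p i then s i else 0) $$ (i,j) \<noteq> 0" if "i < n" for i
    by (rule ex1I[of _ "p i"]) (use that nz pn in \<open>auto split: if_splits\<close>)
  moreover have "\<exists>!i. i < n \<and> mat n n (\<lambda>(i,j). if j = p i then s i else 0) $$ (i,j) \<noteq> 0"
    if "j < n" for j
  proof -
    obtain i where i: "i < n" "p i = j"
      using p \<open>j < n\<close> unfolding bij_betw_def by (metis imageE lessThan_iff)
    show ?thesis
    proof (rule ex1I[of _ i])
      fix i' assume "i' < n \<and> mat n n (\<lambda>(i,j). if j = p i then s i else 0) $$ (i',j) \<noteq> 0"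
      then have "i' < n" "p i' = p i" using i that by (auto split: if_splits)
      then show "i' = i" using i p by (auto simp: bij_betw_def inj_on_def)
    qed (use i that nz in auto)
  qed
  ultimately show ?thesis using s by (auto simp: Mon_def)
qed

text \<open>Each inner sum collapses to a single term. As \<open>R\<close> enters transposed, its
  row \<open>j\<close> acts on column \<open>j\<close> of \<open>A\<close>, so rows and columns
  follow the same rule.\<close>

lemma monomial_product_entry:
  fixes A :: "int mat"
  assumes L: "L \<in> carrier_mat m m" "\<And>i j. i < m \<Longrightarrow> j < m \<Longrightarrow> L $$ (i,j) = (if j = p i then s i else 0)"
    and R: "R \<in> carrier_mat n n" "\<And>i j. i < n \<Longrightarrow> j < n \<Longrightarrow> R $$ (i,j) = (if j = q i then t i else 0)"
    and A: "A \<in> carrier_mat m n" and ij: "i < m" "j < n" "p i < m" "q j < n"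
  shows "(L * A * transpose_mat R) $$ (i,j) = s i * t j * A $$ (p i, q j)"
proof -
  have LA: "(L * A) $$ (i,l) = s i * A $$ (p i, l)" if "l < n" for l
  proof -
    have "(L * A) $$ (i,l) = (\<Sum>k = 0..<m. L $$ (i,k) * A $$ (k,l))"
      using assms that by (simp add: scalar_prod_def)
    also have "\<dots> = (\<Sum>k = 0..<m. if k = p i then s i * A $$ (k,l) else 0)"
      by (rule sum.cong) (use assms in auto)
    also have "\<dots> = s i * A $$ (p i, l)" using ij by simp
    finally show ?thesis .
  qed
  have "(L * A * transpose_mat R) $$ (i,j) = (\<Sum>l = 0..<n. (L * A) $$ (i,l) * R $$ (j,l))"
    using L(1) R(1) A ij by (simp add: scalar_prod_def del: assoc_mult_mat)
  also have "\<dots> = (\<Sum>l = 0..<n. if l = q j then s i * A $$ (p i, l) * t j else 0)"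
    by (rule sum.cong) (use assms LA in auto)
  also have "\<dots> = s i * t j * A $$ (p i, q j)" using ij by simp
  finally show ?thesis .
qed

text \<open>Together with \<open>H_equivE\<close> this trades the matrix product for two bijections
  and two sign functions, the form in which later proofs handle H-equivalence.\<close>

lemma H_equivI:
  assumes "dim_row B = dim_row A" "dim_col B = dim_col A"
    and p: "bij_betw p {..<dim_row A} {..<dim_row A}" and q: "bij_betw q {..<dim_col A} {..<dim_col A}"
    and s: "\<And>i. s i \<in> {1, -1 :: int}" and t: "\<And>j. t j \<in> {1, -1 :: int}"
    and e: "\<And>i j. i < dim_row A \<Longrightarrow> j < dim_col A \<Longrightarrow> B $$ (i,j) = s i * t j * A $$ (p i, q j)"
  shows "A \<sim>\<^sub>H B"
proof -
  let ?L = "mat (dim_row A) (dim_row A) (\<lambda>(i,j). if j = p i then s i else 0)"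
  let ?R = "mat (dim_col A) (dim_col A) (\<lambda>(i,j). if j = q i then t i else 0)"
  have "B = ?L * A * transpose_mat ?R"
  proof (rule eq_matI)
    fix i j assume "i < dim_row (?L * A * transpose_mat ?R)" "j < dim_col (?L * A * transpose_mat ?R)"
    then have ij: "i < dim_row A" "j < dim_col A" by auto
    then have "p i < dim_row A" "q j < dim_col A" using p q by (auto dest: bij_betwE)
    then have "(?L * A * transpose_mat ?R) $$ (i,j) = s i * t j * A $$ (p i, q j)"
      using ij by (intro monomial_product_entry[of _ "dim_row A" _ _ _ "dim_col A"]) auto
    then show "B $$ (i,j) = (?L * A * transpose_mat ?R) $$ (i,j)" using e ij by simp
  qed (use assms in auto)
  then show ?thesis
    unfolding H_equiv_def using mat_in_Mon[of p _ s, OF p s] mat_in_Mon[of q _ t, OF q t] by blast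
qed

lemma H_equivE:
  assumes "A \<sim>\<^sub>H B"
  obtains p q s t where "dim_row B = dim_row A" "dim_col B = dim_col A"
    "bij_betw p {..<dim_row A} {..<dim_row A}" "bij_betw q {..<dim_col A} {..<dim_col A}"
    "\<And>i. s i \<in> {1, -1 :: int}" "\<And>j. t j \<in> {1, -1 :: int}"
    "\<And>i j. i < dim_row A \<Longrightarrow> j < dim_col A \<Longrightarrow> B $$ (i,j) = s i * t j * A $$ (p i, q j)"
proof -
  from assms obtain L R where LR: "L \<in> Mon (dim_row A)" "R \<in> Mon (dim_col A)"
    and B: "B = L * A * transpose_mat R" unfolding H_equiv_def by blast
  have c: "L \<in> carrier_mat (dim_row A) (dim_row A)" "R \<in> carrier_mat (dim_col A) (dim_col A)"
    using LR by (auto simp: Mon_def)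
  obtain p s where p: "bij_betw p {..<dim_row A} {..<dim_row A}" "\<And>i. s i \<in> {1, -1 :: int}"
    "\<And>i j. i < dim_row A \<Longrightarrow> j < dim_row A \<Longrightarrow> L $$ (i,j) = (if j = p i then s i else 0)"
    using Mon_entries[OF LR(1)] by blast
  obtain q t where q: "bij_betw q {..<dim_col A} {..<dim_col A}" "\<And>i. t i \<in> {1, -1 :: int}"
    "\<And>i j. i < dim_col A \<Longrightarrow> j < dim_col A \<Longrightarrow> R $$ (i,j) = (if j = q i then t i else 0)"
    using Mon_entries[OF LR(2)] by blast
  have "B $$ (i,j) = s i * t j * A $$ (p i, q j)" if ij: "i < dim_row A" "j < dim_col A" for i j
  proof -
    have "p i < dim_row A" "q j < dim_col A" using ij p(1) q(1) by (auto dest: bij_betwE)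
    then show ?thesis unfolding B
      by (intro monomial_product_entry[of _ "dim_row A" _ _ _ "dim_col A"] c p q ij) auto
  qed
  moreover have "dim_row B = dim_row A" "dim_col B = dim_col A" using c B by auto
  ultimately show ?thesis by (intro that[OF _ _ p(1) q(1) p(2) q(2)])
qed

lemma H_equiv_refl: "A \<sim>\<^sub>H A"
  by (rule H_equivI[where p = id and q = id and s = "\<lambda>_. 1" and t = "\<lambda>_. 1"]) auto

lemma H_equiv_trans:
  assumes "A \<sim>\<^sub>H B" "B \<sim>\<^sub>H C"
  shows "A \<sim>\<^sub>H C"
proof -
  from assms(1) obtain p q s t where 1: "dim_row B = dim_row A" "dim_col B = dim_col A"
    "bij_betw p {..<dim_row A} {..<dim_row A}" "bij_betw q {..<dim_col A} {..<dim_col A}"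
    "\<And>i. s i \<in> {1, -1 :: int}" "\<And>j. t j \<in> {1, -1 :: int}"
    "\<And>i j. i < dim_row A \<Longrightarrow> j < dim_col A \<Longrightarrow> B $$ (i,j) = s i * t j * A $$ (p i, q j)"
    by (rule H_equivE) blast
  from assms(2) obtain p' q' s' t' where 2: "dim_row C = dim_row B" "dim_col C = dim_col B"
    "bij_betw p' {..<dim_row B} {..<dim_row B}" "bij_betw q' {..<dim_col B} {..<dim_col B}"
    "\<And>i. s' i \<in> {1, -1 :: int}" "\<And>j. t' j \<in> {1, -1 :: int}"
    "\<And>i j. i < dim_row B \<Longrightarrow> j < dim_col B \<Longrightarrow> C $$ (i,j) = s' i * t' j * B $$ (p' i, q' j)"
    by (rule H_equivE) blast
  show ?thesis
  \<comment> \<open>An entry of \<open>C\<close> is first looked up in \<open>B\<close> at the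
    primed indices and then in \<open>A\<close>, which fixes the order of composition and the
    argument of the inner signs.\<close>
  proof (rule H_equivI[where p = "p \<circ> p'" and q = "q \<circ> q'" and s = "\<lambda>i. s' i * s (p' i)"
        and t = "\<lambda>j. t' j * t (q' j)"])
    fix i show "s' i * s (p' i) \<in> {1, -1}" using 1(5)[of "p' i"] 2(5)[of i] by auto
    show "t' i * t (q' i) \<in> {1, -1}" using 1(6)[of "q' i"] 2(6)[of i] by auto
  next
    fix i j assume ij: "i < dim_row A" "j < dim_col A"
    then have "p' i < dim_row A" "q' j < dim_col A"
      using 2(3,4) 1(1,2) by (auto dest: bij_betwE)
    then show "C $$ (i,j) = s' i * s (p' i) * (t' j * t (q' j)) * A $$ ((p \<circ> p') i, (q \<circ> q') j)"
      using 1(1,2,7) 2(7) ij by simp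
  qed (use 1(1-4) 2(1-4) in \<open>auto intro: bij_betw_trans\<close>)
qed

section \<open>Sums of two blocks\<close>

lemma dim_diag_block_mat_pair [simp]:
  "dim_row (diag_block_mat [A, B]) = dim_row A + dim_row B"
  "dim_col (diag_block_mat [A, B]) = dim_col A + dim_col B"
  by (simp_all add: dim_diag_block_mat)

lemma index_diag_block_mat_pair:
  assumes "i < dim_row A + dim_row B" "j < dim_col A + dim_col B"
  shows "diag_block_mat [A, B] $$ (i,j) =
    (if i < dim_row A then if j < dim_col A then A $$ (i,j) else 0
     else if j < dim_col A then 0 else B $$ (i - dim_row A, j - dim_col A))"
  using assms by (auto simp: Let_def)

text \<open>Reduces lists of blocks to sums of two, whose entries are given by one explicit case
  distinction; the tail counts as a single block.\<close>

lemma diag_block_mat_Cons_pair: "diag_block_mat (A # As) = diag_block_mat [A, diag_block_mat As]"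
  unfolding diag_block_mat.simps(2)[of A] Let_def diag_block_mat_singleton ..

lemma diag_block_mat_append_pair:
  "diag_block_mat (As @ Bs) = diag_block_mat [diag_block_mat As, diag_block_mat Bs]"
  unfolding diag_block_mat_append diag_block_mat.simps(2)[of "diag_block_mat As"]
    Let_def diag_block_mat_singleton ..

text \<open>Only the argument is shifted, not the value, so the same construction serves signs and
  permutations; for a permutation the offset \<open>m\<close> is added to the second function
  separately.\<close>

definition glue :: "nat \<Rightarrow> (nat \<Rightarrow> 'a) \<Rightarrow> (nat \<Rightarrow> 'a) \<Rightarrow> nat \<Rightarrow> 'a" where
  "glue m f g i = (if i < m then f i else g (i - m))"

lemma bij_betw_glue:
  assumes p: "bij_betw p {..<m} {..<m}" and q: "bij_betw q {..<n} {..<n}"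
  shows "bij_betw (glue m p (\<lambda>i. m + q i)) {..<m + n} {..<m + n}"
proof -
  have *: "bij_betw (glue m p (\<lambda>i. m + q i)) {..<m} {..<m}"
    using p by (subst bij_betw_cong[of _ _ p]) (auto simp: glue_def)
  have "bij_betw (\<lambda>i. i - m) {m..<m+n} {..<n}"
    by (rule bij_betwI[where g = "\<lambda>i. m + i"]) auto
  from bij_betw_trans[OF this q] have "bij_betw (q \<circ> (\<lambda>i. i - m)) {m..<m+n} {..<n}" .
  moreover have "bij_betw (\<lambda>i. m + i) {..<n} {m..<m+n}"
    by (rule bij_betwI[where g = "\<lambda>i. i - m"]) auto
  ultimately have "bij_betw ((\<lambda>i. m + i) \<circ> (q \<circ> (\<lambda>i. i - m))) {m..<m+n} {m..<m+n}"
    by (rule bij_betw_trans)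
  then have "bij_betw (glue m p (\<lambda>i. m + q i)) {m..<m+n} {m..<m+n}"
    by (subst bij_betw_cong[where g = "(\<lambda>i. m + i) \<circ> (q \<circ> (\<lambda>i. i - m))"]) (auto simp: glue_def)
  from bij_betw_combine[OF * this] show ?thesis
    by (simp add: ivl_disj_un ivl_disj_int)
qed

lemma H_equiv_diag_block_mat_pair:
  assumes "A \<sim>\<^sub>H A'" "B \<sim>\<^sub>H B'"
  shows "diag_block_mat [A, B] \<sim>\<^sub>H diag_block_mat [A', B']"
proof -
  from assms(1) obtain p q s t where 1: "dim_row A' = dim_row A" "dim_col A' = dim_col A"
    "bij_betw p {..<dim_row A} {..<dim_row A}" "bij_betw q {..<dim_col A} {..<dim_col A}"
    "\<And>i. s i \<in> {1, -1 :: int}" "\<And>j. t j \<in> {1, -1 :: int}"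
    "\<And>i j. i < dim_row A \<Longrightarrow> j < dim_col A \<Longrightarrow> A' $$ (i,j) = s i * t j * A $$ (p i, q j)"
    by (rule H_equivE) blast
  from assms(2) obtain p' q' s' t' where 2: "dim_row B' = dim_row B" "dim_col B' = dim_col B"
    "bij_betw p' {..<dim_row B} {..<dim_row B}" "bij_betw q' {..<dim_col B} {..<dim_col B}"
    "\<And>i. s' i \<in> {1, -1 :: int}" "\<And>j. t' j \<in> {1, -1 :: int}"
    "\<And>i j. i < dim_row B \<Longrightarrow> j < dim_col B \<Longrightarrow> B' $$ (i,j) = s' i * t' j * B $$ (p' i, q' j)"
    by (rule H_equivE) blast
  let ?P = "glue (dim_row A) p (\<lambda>i. dim_row A + p' i)" and ?Q = "glue (dim_col A) q (\<lambda>i. dim_col A + q' i)"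
  note P = bij_betw_glue[OF 1(3) 2(3)] and Q = bij_betw_glue[OF 1(4) 2(4)]
  show ?thesis
  proof (rule H_equivI[where p = ?P and q = ?Q
        and s = "glue (dim_row A) s s'" and t = "glue (dim_col A) t t'"])
    fix i show "glue (dim_row A) s s' i \<in> {1, -1}" using 1(5)[of i] 2(5) by (simp add: glue_def)
    show "glue (dim_col A) t t' i \<in> {1, -1}" using 1(6)[of i] 2(6) by (simp add: glue_def)
  next
    fix i j assume ij': "i < dim_row (diag_block_mat [A, B])" "j < dim_col (diag_block_mat [A, B])"
    then have ij: "i < dim_row A + dim_row B" "j < dim_col A + dim_col B" by simp_all
    have PQ: "?P i < dim_row A + dim_row B" "?Q j < dim_col A + dim_col B"
      using P Q ij by (auto dest!: bij_betwE)
    have pq: "i < dim_row A \<Longrightarrow> p i < dim_row A" "j < dim_col A \<Longrightarrow> q j < dim_col A"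
      using 1(3,4) by (auto dest!: bij_betwE)
    show "diag_block_mat [A', B'] $$ (i,j) =
      glue (dim_row A) s s' i * glue (dim_col A) t t' j * diag_block_mat [A, B] $$ (?P i, ?Q j)"
      using ij PQ pq 1(1,2,7) 2(1,2,7)
      by (simp add: index_diag_block_mat_pair del: diag_block_mat.simps) (auto simp: glue_def)
  qed (use 1 2 P Q in \<open>simp_all del: diag_block_mat.simps\<close>)
qed

section \<open>Integer weighing matrices\<close>

lemma integer_weighing_iff:
  "integer_weighing A \<longleftrightarrow> dim_col A = dim_row A \<and>
     (\<exists>k. \<forall>i<dim_row A. \<forall>j<dim_row A.
        (\<Sum>c<dim_row A. A $$ (i,c) * A $$ (j,c)) = (if i = j then k else 0))"
  by (auto simp: integer_weighing_def mat_eq_iff scalar_prod_def atLeast0LessThan mult_ac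
      intro!: exI)

text \<open>In an inner product of two rows the column signs occur squared, \<open>q\<close> only
  reorders the summands, and the row signs factor out; their product is 1 when the rows coincide,
  and otherwise the sum is 0.\<close>

lemma integer_weighing_H_equiv:
  assumes "A \<sim>\<^sub>H B" "integer_weighing A"
  shows "integer_weighing B"
proof -
  from assms(1) obtain p q s t where 1: "dim_row B = dim_row A" "dim_col B = dim_col A"
    "bij_betw p {..<dim_row A} {..<dim_row A}" "bij_betw q {..<dim_col A} {..<dim_col A}"
    "\<And>i. s i \<in> {1, -1 :: int}" "\<And>j. t j \<in> {1, -1 :: int}"
    "\<And>i j. i < dim_row A \<Longrightarrow> j < dim_col A \<Longrightarrow> B $$ (i,j) = s i * t j * A $$ (p i, q j)"
    by (rule H_equivE) blast
  from assms(2) obtain k where sq: "dim_col A = dim_row A"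
    and k: "\<And>i j. i < dim_row A \<Longrightarrow> j < dim_row A \<Longrightarrow>
      (\<Sum>c<dim_row A. A $$ (i,c) * A $$ (j,c)) = (if i = j then k else 0)"
    unfolding integer_weighing_iff by blast
  have ss: "s i * s i = 1" "t i * t i = 1" for i using 1(5)[of i] 1(6)[of i] by auto
  have "(\<Sum>c<dim_row A. B $$ (i,c) * B $$ (j,c)) = (if i = j then k else 0)"
    if ij: "i < dim_row A" "j < dim_row A" for i j
  proof -
    have "B $$ (i,c) * B $$ (j,c) = s i * s j * (A $$ (p i, q c) * A $$ (p j, q c))"
      if "c < dim_row A" for c
    proof -
      have "B $$ (i,c) * B $$ (j,c) = (t c * t c) * (s i * s j * (A $$ (p i, q c) * A $$ (p j, q c)))"
        using 1(7)[of i c] 1(7)[of j c] ij that sq by (simp add: mult_ac)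
      then show ?thesis by (simp add: ss)
    qed
    then have "(\<Sum>c<dim_row A. B $$ (i,c) * B $$ (j,c)) =
        s i * s j * (\<Sum>c<dim_row A. A $$ (p i, q c) * A $$ (p j, q c))"
      by (simp add: sum_distrib_left)
    also have "(\<Sum>c<dim_row A. A $$ (p i, q c) * A $$ (p j, q c)) =
        (\<Sum>c<dim_row A. A $$ (p i, c) * A $$ (p j, c))"
      using sum.reindex_bij_betw[OF 1(4)[unfolded sq]] .
    also have "\<dots> = (if p i = p j then k else 0)"
      using k 1(3) ij by (auto dest!: bij_betwE)
    also have "(p i = p j) = (i = j)" using 1(3) ij by (auto simp: bij_betw_def inj_on_def)
    finally show ?thesis using ss by auto
  qed
  then show ?thesis unfolding integer_weighing_iff using 1(1,2) sq by auto
qed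

lemma sum_lessThan_add:
  fixes f :: "nat \<Rightarrow> 'a :: comm_monoid_add"
  shows "(\<Sum>c<m + n. f c) = (\<Sum>c<m. f c) + (\<Sum>c<n. f (m + c))"
  by (induction n) (simp_all add: add.assoc)

text \<open>In an inner product of two rows through the same block, the columns of the other block
  contribute 0. Both blocks inherit the constant \<open>k\<close>.\<close>

lemma integer_weighing_diag_block_mat_pair:
  assumes "integer_weighing (diag_block_mat [A, B])" "square_mat A" "square_mat B"
  shows "integer_weighing A" "integer_weighing B"
proof -
  let ?D = "diag_block_mat [A, B]" let ?m = "dim_row A" and ?n = "dim_row B"
  have sq: "dim_col A = ?m" "dim_col B = ?n" using assms by auto
  from assms(1) obtain k where k: "\<And>i j. i < ?m + ?n \<Longrightarrow> j < ?m + ?n \<Longrightarrow>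
      (\<Sum>c<?m + ?n. ?D $$ (i,c) * ?D $$ (j,c)) = (if i = j then k else 0)"
    unfolding integer_weighing_iff dim_diag_block_mat_pair by blast
  have "(\<Sum>c<?m. A $$ (i,c) * A $$ (j,c)) = (if i = j then k else 0)"
    if ij: "i < ?m" "j < ?m" for i j
    using k[of i j] ij unfolding sum_lessThan_add
    by (simp add: index_diag_block_mat_pair sq del: diag_block_mat.simps)
  then show "integer_weighing A" unfolding integer_weighing_iff using sq by blast
  have "(\<Sum>c<?n. B $$ (i,c) * B $$ (j,c)) = (if i = j then k else 0)"
    if ij: "i < ?n" "j < ?n" for i j
    using k[of "?m + i" "?m + j"] ij unfolding sum_lessThan_add
    by (simp add: index_diag_block_mat_pair sq del: diag_block_mat.simps)
  then show "integer_weighing B" unfolding integer_weighing_iff using sq by blast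
qed

section \<open>Existence of the decomposition\<close>

theorem primitive_decomposition_exists:
  assumes "integer_weighing A"
  shows "\<exists>As. (\<forall>B \<in> set As. primitive_weighing B) \<and> A \<sim>\<^sub>H diag_block_mat As"
  using assms
proof (induction "dim_row A" arbitrary: A rule: less_induct)
  case less
  show ?case
  proof (cases "dim_row A = 0 \<or> primitive_weighing A")
    case True
    then show ?thesis
    proof
      assume "dim_row A = 0"
      then have "A = diag_block_mat []" using less.prems by (auto simp: integer_weighing_def)
      then show ?thesis using H_equiv_refl by (metis empty_iff list.set(1))
    next
      assume "primitive_weighing A"
      then show ?thesis using H_equiv_refl[of A] by (intro exI[of _ "[A]"]) (simp del: diag_block_mat.simps)
    qed
  next
    case False
    then obtain Bs where Bs: "2 \<le> length Bs"
      "\<forall>B \<in> set Bs. square_mat B \<and> 0 < dim_row B \<and> dim_row B < dim_row A" "A \<sim>\<^sub>H diag_block_mat Bs"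
      using less.prems by (auto simp: primitive_weighing_def)
    obtain B Bs' where B: "Bs = B # Bs'" using Bs(1) by (cases Bs) auto
    \<comment> \<open>Merging all blocks but the first leaves a sum of two matrices; the merged one
      is smaller than \<open>A\<close> because \<open>B\<close> has at least one row.\<close>
    let ?D = "diag_block_mat Bs'"
    have D: "A \<sim>\<^sub>H diag_block_mat [B, ?D]" using Bs(3) B diag_block_mat_Cons_pair by metis
    have sq: "square_mat B" "square_mat ?D" using Bs(2) B diag_block_mat_square[of Bs'] by auto
    have "dim_row A = dim_row B + dim_row ?D"
      using D by (rule H_equivE) (simp del: diag_block_mat.simps)
    moreover have "0 < dim_row B" "dim_row B < dim_row A" using Bs(2) B by auto
    ultimately have small: "dim_row B < dim_row A" "dim_row ?D < dim_row A" by auto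
    have w: "integer_weighing B" "integer_weighing ?D"
      using integer_weighing_diag_block_mat_pair[OF integer_weighing_H_equiv[OF D less.prems] sq]
      by auto
    obtain As1 where 1: "\<forall>B \<in> set As1. primitive_weighing B" "B \<sim>\<^sub>H diag_block_mat As1"
      using less.hyps[OF small(1) w(1)] by blast
    obtain As2 where 2: "\<forall>B \<in> set As2. primitive_weighing B" "?D \<sim>\<^sub>H diag_block_mat As2"
      using less.hyps[OF small(2) w(2)] by blast
    have "A \<sim>\<^sub>H diag_block_mat (As1 @ As2)"
      unfolding diag_block_mat_append_pair
      by (rule H_equiv_trans[OF D H_equiv_diag_block_mat_pair[OF 1(2) 2(2)]])
    then show ?thesis using 1(1) 2(1) by (intro exI[of _ "As1 @ As2"]) auto
  qed
qed

section \<open>Connectedness of primitive matrices\<close>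

text \<open>If \<open>k\<close> were 0, every row would have vanishing sum of squares and
  \<open>A\<close> would be zero. Otherwise the square of the determinant is a power of
  \<open>k\<close>, hence nonzero, and some term of the Leibniz expansion survives.\<close>

lemma integer_weighing_transversal:
  assumes "integer_weighing A" "A \<noteq> 0\<^sub>m (dim_row A) (dim_row A)"
  obtains \<sigma> where "\<sigma> permutes {..<dim_row A}" "\<And>i. i < dim_row A \<Longrightarrow> A $$ (i, \<sigma> i) \<noteq> 0"
proof -
  let ?n = "dim_row A"
  from assms(1) obtain k where sq: "dim_col A = ?n" and k: "A * transpose_mat A = k \<cdot>\<^sub>m 1\<^sub>m ?n"
    unfolding integer_weighing_def by auto
  have c: "A \<in> carrier_mat ?n ?n" "transpose_mat A \<in> carrier_mat ?n ?n" using sq by auto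
  have "k \<noteq> 0"
  proof
    assume k0: "k = 0"
    have "A $$ (i,j) = 0" if ij: "i < ?n" "j < ?n" for i j
    proof -
      have "(A * transpose_mat A) $$ (i,i) = 0" unfolding k using k0 ij by simp
      then have "(\<Sum>c = 0..<?n. A $$ (i,c) * A $$ (i,c)) = 0"
        using ij sq by (simp add: scalar_prod_def)
      then show ?thesis using ij by (subst (asm) sum_nonneg_eq_0_iff) auto
    qed
    then have "A = 0\<^sub>m ?n ?n" using sq by (intro eq_matI) auto
    then show False using assms(2) by simp
  qed
  moreover have "det A * det A = k ^ ?n"
    using det_mult[OF c] det_transpose[OF c(1)] unfolding k by simp
  ultimately have "det A \<noteq> 0" by (metis mult_zero_left power_not_zero)
  then obtain \<sigma> where \<sigma>: "\<sigma> permutes {0..<?n}" "(\<Prod>i = 0..<?n. A $$ (i, \<sigma> i)) \<noteq> 0"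
    unfolding det_def'[OF c(1)] by (metis (mono_tags, lifting) mem_Collect_eq mult_zero_right sum.neutral)
  then show ?thesis using that[of \<sigma>] by (auto simp: atLeast0LessThan)
qed

text \<open>Serves to move a chosen set of rows or columns to the front; the complement fills the
  remaining places.\<close>

lemma bij_betw_initial_segment:
  assumes "I \<subseteq> {..<n}"
  obtains p where "bij_betw p {..<n} {..<n}" "p ` {..<card I} = I"
proof -
  have fin: "finite I" using assms finite_subset by blast
  have le: "card I \<le> n" using card_mono[OF _ assms] by simp
  obtain f where f: "bij_betw f {..<card I} I"
    using finite_same_card_bij[of "{..<card I}" I] fin by auto
  have "card {card I..<n} = card ({..<n} - I)" using card_Diff_subset[OF fin assms] by simp
  then obtain g where g: "bij_betw g {card I..<n} ({..<n} - I)"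
    using finite_same_card_bij[of "{card I..<n}" "{..<n} - I"] by auto
  let ?p = "\<lambda>i. if i \<in> {..<card I} then f i else g i"
  have "bij_betw ?p ({..<card I} \<union> {card I..<n}) (I \<union> ({..<n} - I))"
    by (rule bij_betw_disjoint_Un[OF f g]) auto
  moreover have "{..<card I} \<union> {card I..<n} = {..<n}" "I \<union> ({..<n} - I) = {..<n}"
    using le assms by auto
  moreover have "?p ` {..<card I} = I" using f by (auto simp: bij_betw_def)
  ultimately show ?thesis using that[of ?p] by simp
qed

text \<open>Moving the rows in \<open>I\<close> and the columns in \<open>J\<close> to the front
  makes both off-diagonal blocks vanish. Equal cardinalities make the diagonal blocks square, and
  \<open>I\<close> being nonempty and proper makes both of them nonempty and smaller than
  \<open>A\<close>.\<close>

lemma not_primitive_if_split: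
  assumes sq: "dim_col A = dim_row A"
    and IJ: "I \<subseteq> {..<dim_row A}" "J \<subseteq> {..<dim_row A}" "card J = card I"
    and I: "I \<noteq> {}" "I \<noteq> {..<dim_row A}"
    and z: "\<And>i j. i < dim_row A \<Longrightarrow> j < dim_row A \<Longrightarrow> (i \<in> I) \<noteq> (j \<in> J) \<Longrightarrow> A $$ (i,j) = 0"
  shows "\<not> primitive_weighing A"
proof -
  let ?n = "dim_row A" and ?m = "card I"
  obtain p where p: "bij_betw p {..<?n} {..<?n}" "p ` {..<?m} = I"
    using bij_betw_initial_segment[OF IJ(1)] by blast
  obtain q where q: "bij_betw q {..<?n} {..<?n}" "q ` {..<?m} = J"
    using bij_betw_initial_segment[OF IJ(2)] IJ(3) by metis
  have m: "0 < ?m" "?m < ?n"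
    using I(1) finite_subset[OF IJ(1)] psubset_card_mono[of "{..<?n}" I] IJ(1) I(2)
    by (auto simp: card_gt_0_iff)
  have pI: "p i \<in> I \<longleftrightarrow> i < ?m" if "i < ?n" for i
    using inj_on_image_mem_iff[of p "{..<?n}" i "{..<?m}"] p m that by (auto simp: bij_betw_def)
  have qJ: "q i \<in> J \<longleftrightarrow> i < ?m" if "i < ?n" for i
    using inj_on_image_mem_iff[of q "{..<?n}" i "{..<?m}"] q m that by (auto simp: bij_betw_def)
  define B where "B = mat ?m ?m (\<lambda>(i,j). A $$ (p i, q j))"
  define D where "D = mat (?n - ?m) (?n - ?m) (\<lambda>(i,j). A $$ (p (?m + i), q (?m + j)))"
  have dims [simp]: "dim_row B = ?m" "dim_col B = ?m" "dim_row D = ?n - ?m" "dim_col D = ?n - ?m"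
    by (simp_all add: B_def D_def)
  have "A \<sim>\<^sub>H diag_block_mat [B, D]"
  proof (rule H_equivI[where p = p and q = q and s = "\<lambda>_. 1" and t = "\<lambda>_. 1"])
    fix i j assume ij: "i < dim_row A" "j < dim_col A"
    have pq: "p i < ?n" "q j < ?n" using p(1) q(1) ij sq by (auto dest!: bij_betwE)
    have "diag_block_mat [B, D] $$ (i,j) = A $$ (p i, q j)"
      using ij m sq z[OF pq] pI[of i] qJ[of j]
      by (subst index_diag_block_mat_pair) (auto simp: B_def D_def)
    then show "diag_block_mat [B, D] $$ (i,j) = 1 * 1 * A $$ (p i, q j)" by simp
  qed (use p q sq m in \<open>simp_all del: diag_block_mat.simps\<close>)
  moreover have "\<forall>C \<in> set [B, D]. square_mat C \<and> 0 < dim_row C \<and> dim_row C < dim_row A"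
    using m by auto
  moreover have "2 \<le> length [B, D]" by simp
  ultimately show ?thesis unfolding primitive_weighing_def by blast
qed

lemma primitive_weighing_square: "primitive_weighing A \<Longrightarrow> dim_col A = dim_row A"
  by (auto simp: primitive_weighing_def integer_weighing_def)

text \<open>A larger zero matrix splits off its first row and column.\<close>

lemma primitive_weighing_zero:
  assumes "primitive_weighing (0\<^sub>m n n)"
  shows "n = 1"
proof (rule ccontr)
  assume "n \<noteq> 1"
  then have "1 < n" using assms by (auto simp: primitive_weighing_def)
  then have "\<not> primitive_weighing (0\<^sub>m n n)"
    by (intro not_primitive_if_split[of _ "{0}" "{0}"]) auto
  then show False using assms by simp
qed

text \<open>A transversal of nonzero entries hits every column. In the uniqueness proof this ties
  each column of a nonzero block to one of its rows.\<close>

lemma primitive_weighing_column_nonzero: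
  assumes "primitive_weighing A" "A \<noteq> 0\<^sub>m (dim_row A) (dim_row A)" "c < dim_row A"
  obtains r where "r < dim_row A" "A $$ (r,c) \<noteq> 0"
proof -
  obtain \<sigma> where \<sigma>: "\<sigma> permutes {..<dim_row A}" "\<And>i. i < dim_row A \<Longrightarrow> A $$ (i, \<sigma> i) \<noteq> 0"
    using integer_weighing_transversal[OF _ assms(2)] assms(1)
    unfolding primitive_weighing_def by blast
  obtain r where "r < dim_row A" "\<sigma> r = c"
    using permutes_image[OF \<sigma>(1)] assms(3) by (metis imageE lessThan_iff)
  then show ?thesis using that \<sigma>(2) by blast
qed

text \<open>A nonzero term of the Leibniz expansion of the determinant maps the rows in \<open>I\<close> to the
  columns meeting \<open>I\<close>, and the other rows to the other columns; so these sets have equal size.\<close>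

lemma primitive_weighing_connected:
  assumes prim: "primitive_weighing A" and I: "I \<subseteq> {..<dim_row A}" "I \<noteq> {}"
    and closed: "\<And>i i' c. i \<in> I \<Longrightarrow> i' < dim_row A \<Longrightarrow> c < dim_row A \<Longrightarrow>
      A $$ (i,c) \<noteq> 0 \<Longrightarrow> A $$ (i',c) \<noteq> 0 \<Longrightarrow> i' \<in> I"
  shows "I = {..<dim_row A}"
proof (cases "A = 0\<^sub>m (dim_row A) (dim_row A)")
  case True
  then have "dim_row A = 1" using primitive_weighing_zero prim by metis
  then show ?thesis using I by auto
next
  case False
  let ?n = "dim_row A"
  obtain \<sigma> where \<sigma>: "\<sigma> permutes {..<?n}" "\<And>i. i < ?n \<Longrightarrow> A $$ (i, \<sigma> i) \<noteq> 0"
    using integer_weighing_transversal[OF _ False] prim unfolding primitive_weighing_def by blast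
  have \<sigma>n: "\<sigma> i < ?n" if "i < ?n" for i using permutes_in_image[OF \<sigma>(1)] that by auto
  have z: "A $$ (i,j) = 0" if ij: "i < ?n" "j < ?n" "(i \<in> I) \<noteq> (j \<in> \<sigma> ` I)" for i j
  proof (rule ccontr)
    assume nz: "A $$ (i,j) \<noteq> 0"
    obtain i' where i': "i' < ?n" "\<sigma> i' = j"
      using permutes_image[OF \<sigma>(1)] ij(2) by (metis imageE lessThan_iff)
    have "j \<in> \<sigma> ` I \<longleftrightarrow> i' \<in> I"
      using i' permutes_inj[OF \<sigma>(1)] by (auto simp: inj_def)
    \<comment> \<open>Rows \<open>i\<close> and \<open>i'\<close> both have a nonzero entry in
      column \<open>j\<close>, so closedness of \<open>I\<close> applies in both directions.\<close>
    moreover have "i \<in> I \<longleftrightarrow> i' \<in> I"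
      using closed[of i i' j] closed[of i' i j] i' ij \<sigma>(2)[of i'] nz by auto
    ultimately show False using ij(3) by blast
  qed
  have "card (\<sigma> ` I) = card I"
    using permutes_inj[OF \<sigma>(1)] by (intro card_image) (auto simp: inj_def inj_on_def)
  moreover have "\<sigma> ` I \<subseteq> {..<?n}" using \<sigma>n I by auto
  ultimately show ?thesis
    using not_primitive_if_split[OF primitive_weighing_square[OF prim] I(1) _ _ I(2) _ z] prim by blast
qed

section \<open>Uniqueness\<close>

definition block_index :: "'a mat list \<Rightarrow> (nat \<times> nat) set" where
  "block_index As = (SIGMA i : {..<length As}. {..<dim_row (As ! i)})"

definition block_entry :: "'a :: zero mat list \<Rightarrow> nat \<times> nat \<Rightarrow> nat \<times> nat \<Rightarrow> 'a" where
  "block_entry As x y = (if fst x = fst y then As ! fst x $$ (snd x, snd y) else 0)"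

text \<open>Offsets count rows, but they also number the columns once all blocks are square; one set
  of coordinates then serves both sides.\<close>

definition block_pos :: "'a mat list \<Rightarrow> nat \<times> nat \<Rightarrow> nat" where
  "block_pos As x = sum_list (map dim_row (take (fst x) As)) + snd x"

lemma mem_block_index: "x \<in> block_index As \<longleftrightarrow> fst x < length As \<and> snd x < dim_row (As ! fst x)"
  by (cases x) (auto simp: block_index_def)

lemma block_pos_less: "x \<in> block_index As \<Longrightarrow> block_pos As x < dim_row (diag_block_mat As)"
proof (induction As arbitrary: x)
  case Nil
  then show ?case by (simp add: mem_block_index)
next
  case (Cons A As)
  show ?case
  proof (cases "fst x")
    case 0
    then show ?thesis using Cons.prems by (simp add: mem_block_index block_pos_def Let_def)
  next
    case (Suc i)
    then have "(i, snd x) \<in> block_index As" using Cons.prems by (simp add: mem_block_index)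
    from Cons.IH[OF this] show ?thesis using Suc by (simp add: block_pos_def Let_def)
  qed
qed

lemma inj_on_block_pos: "inj_on (block_pos As) (block_index As)"
proof (induction As)
  case Nil
  show ?case by (simp add: block_index_def)
next
  case (Cons A As)
  show ?case
  proof (rule inj_onI)
    fix x y assume xy: "x \<in> block_index (A # As)" "y \<in> block_index (A # As)"
      and eq: "block_pos (A # As) x = block_pos (A # As) y"
    show "x = y"
    proof (cases "fst x"; cases "fst y")
      fix i j assume ij: "fst x = Suc i" "fst y = Suc j"
      then have "(i, snd x) \<in> block_index As" "(j, snd y) \<in> block_index As"
        "block_pos As (i, snd x) = block_pos As (j, snd y)"
        using xy eq by (simp_all add: mem_block_index block_pos_def)
      then have "(i, snd x) = (j, snd y)" by (rule inj_onD[OF Cons.IH, rotated])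
      then show ?thesis using ij by (simp add: prod_eq_iff)
    qed (use xy eq in \<open>auto simp: mem_block_index block_pos_def prod_eq_iff\<close>)
  qed
qed

lemma block_pos_surj:
  "r < dim_row (diag_block_mat As) \<Longrightarrow> \<exists>x \<in> block_index As. block_pos As x = r"
proof (induction As arbitrary: r)
  case Nil
  then show ?case by simp
next
  case (Cons A As)
  show ?case
  proof (cases "r < dim_row A")
    case True
    then show ?thesis by (intro bexI[of _ "(0, r)"]) (auto simp: mem_block_index block_pos_def)
  next
    case False
    then have "r - dim_row A < dim_row (diag_block_mat As)" using Cons.prems by (simp add: Let_def)
    from Cons.IH[OF this] obtain i a where
      "(i, a) \<in> block_index As" "block_pos As (i, a) = r - dim_row A" by auto
    then show ?thesis using False
      by (intro bexI[of _ "(Suc i, a)"]) (auto simp: mem_block_index block_pos_def)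
  qed
qed

lemma bij_betw_block_pos:
  "bij_betw (block_pos As) (block_index As) {..<dim_row (diag_block_mat As)}"
  unfolding bij_betw_def using inj_on_block_pos block_pos_less block_pos_surj by fastforce

lemma diag_block_mat_block_pos:
  assumes "Ball (set As) square_mat" "x \<in> block_index As" "y \<in> block_index As"
  shows "diag_block_mat As $$ (block_pos As x, block_pos As y) = block_entry As x y"
  using assms
proof (induction As arbitrary: x y)
  case Nil
  then show ?case by (simp add: mem_block_index)
next
  case (Cons A As)
  let ?D = "diag_block_mat As"
  have sq: "dim_col A = dim_row A" "dim_col ?D = dim_row ?D"
    using Cons.prems(1) diag_block_mat_square[of As] by auto
  \<comment> \<open>A coordinate lies in the head block, or it is a coordinate of the tail shifted
    by one block and by the rows of \<open>A\<close>.\<close>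
  have *: "fst z = 0 \<and> snd z < dim_row A \<and> block_pos (A # As) z = snd z \<or>
      (\<exists>i. fst z = Suc i \<and> (i, snd z) \<in> block_index As
        \<and> block_pos (A # As) z = dim_row A + block_pos As (i, snd z)
        \<and> block_pos As (i, snd z) < dim_row ?D)"
    if "z \<in> block_index (A # As)" for z
  proof (cases "fst z")
    case (Suc i)
    then have "(i, snd z) \<in> block_index As" using that by (simp add: mem_block_index)
    then show ?thesis using Suc block_pos_less by (auto simp: block_pos_def)
  qed (use that in \<open>auto simp: mem_block_index block_pos_def\<close>)
  have IH: "?D $$ (block_pos As x, block_pos As y) = block_entry As x y"
    if "x \<in> block_index As" "y \<in> block_index As" for x y
    using Cons.IH Cons.prems(1) that by simp
  show ?case
    using *[OF Cons.prems(2)] *[OF Cons.prems(3)] unfolding diag_block_mat_Cons_pair[of A As]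
    by (elim disjE exE conjE)
      (simp_all add: index_diag_block_mat_pair sq IH block_entry_def del: diag_block_mat.simps)
qed

text \<open>Rows of a block that meet a common column are mapped to one block, since the image of that
  column lies in a single block; connectedness then extends this to all rows of the block.\<close>

lemma rows_to_single_block:
  assumes prim: "\<forall>B \<in> set As. primitive_weighing B"
    and nz: "\<And>x y. x \<in> block_index As \<Longrightarrow> y \<in> block_index As \<Longrightarrow>
      block_entry As x y \<noteq> 0 \<Longrightarrow> block_entry Bs (P x) (Q y) \<noteq> 0"
    and xy: "x \<in> block_index As" "y \<in> block_index As" "fst x = fst y"
  shows "fst (P x) = fst (P y)"
proof -
  let ?A = "As ! fst x"
  define I where "I = {a. a < dim_row ?A \<and> fst (P (fst x, a)) = fst (P x)}"
  have i: "fst x < length As" using xy(1) by (simp add: mem_block_index)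
  have "primitive_weighing ?A" using prim i by auto
  then have "I = {..<dim_row ?A}"
  proof (rule primitive_weighing_connected)
    show "I \<subseteq> {..<dim_row ?A}" by (auto simp: I_def)
    have "snd x \<in> I" using xy(1) by (simp add: I_def mem_block_index)
    then show "I \<noteq> {}" by blast
  next
    fix a a' c assume a: "a \<in> I" "a' < dim_row ?A" "c < dim_row ?A"
      "?A $$ (a,c) \<noteq> 0" "?A $$ (a',c) \<noteq> 0"
    have mem: "(fst x, a) \<in> block_index As" "(fst x, a') \<in> block_index As" "(fst x, c) \<in> block_index As"
      using a i by (auto simp: mem_block_index I_def)
    \<comment> \<open>\<open>block_entry\<close> vanishes between different blocks, so a nonzero
      image entry puts its row and its column into one block.\<close>
    have "fst (P (fst x, a)) = fst (Q (fst x, c))"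
      using nz[OF mem(1,3)] a(4) by (auto simp: block_entry_def split: if_splits)
    moreover have "fst (P (fst x, a')) = fst (Q (fst x, c))"
      using nz[OF mem(2,3)] a(5) by (auto simp: block_entry_def split: if_splits)
    ultimately show "a' \<in> I" using a(1,2) by (simp add: I_def)
  qed
  moreover have "snd y < dim_row ?A" using xy by (simp add: mem_block_index)
  ultimately have "snd y \<in> I" by simp
  then show ?thesis using xy(3) by (simp add: I_def)
qed

theorem primitive_decomposition_unique:
  assumes prim: "\<forall>B \<in> set As. primitive_weighing B" "\<forall>B \<in> set As'. primitive_weighing B"
    and equiv: "diag_block_mat As \<sim>\<^sub>H diag_block_mat As'"
  shows "length As = length As' \<and>
    (\<exists>\<pi>. \<pi> permutes {..<length As} \<and> (\<forall>i<length As. As ! i \<sim>\<^sub>H As' ! \<pi> i))"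
proof -
  let ?D = "diag_block_mat As" and ?D' = "diag_block_mat As'"
  have sq: "Ball (set As) square_mat" "Ball (set As') square_mat"
    using prim by (auto simp: primitive_weighing_square)
  from equiv obtain p q s t where 1: "dim_row ?D' = dim_row ?D" "dim_col ?D' = dim_col ?D"
    "bij_betw p {..<dim_row ?D} {..<dim_row ?D}" "bij_betw q {..<dim_col ?D} {..<dim_col ?D}"
    "\<And>i. s i \<in> {1, -1 :: int}" "\<And>j. t j \<in> {1, -1 :: int}"
    "\<And>i j. i < dim_row ?D \<Longrightarrow> j < dim_col ?D \<Longrightarrow> ?D' $$ (i,j) = s i * t j * ?D $$ (p i, q j)"
    by (rule H_equivE) blast
  have sqD: "dim_col ?D = dim_row ?D" using diag_block_mat_square[OF sq(1)] by simp
  define g where "g = inv_into (block_index As) (block_pos As)"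
  have g: "bij_betw g {..<dim_row ?D} (block_index As)"
    unfolding g_def by (rule bij_betw_inv_into[OF bij_betw_block_pos])
  have pos_g: "block_pos As (g r) = r" if "r < dim_row ?D" for r
    unfolding g_def using bij_betw_inv_into_right[OF bij_betw_block_pos] that by auto
  \<comment> \<open>The entry formula expresses the second matrix through the first, so
    \<open>P\<close> and \<open>Q\<close> lead from coordinates of \<open>As'\<close> to coordinates
    of \<open>As\<close>.\<close>
  define P where "P = g \<circ> (p \<circ> block_pos As')"
  define Q where "Q = g \<circ> (q \<circ> block_pos As')"
  define u where "u = s \<circ> block_pos As'"
  define v where "v = t \<circ> block_pos As'"
  note b' = bij_betw_block_pos[of As', unfolded 1(1)]
  have P: "bij_betw P (block_index As') (block_index As)"
    unfolding P_def by (rule bij_betw_trans[OF bij_betw_trans[OF b' 1(3)] g])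
  have Q: "bij_betw Q (block_index As') (block_index As)"
    unfolding Q_def by (rule bij_betw_trans[OF bij_betw_trans[OF b' 1(4)[unfolded sqD]] g])
  have uv: "u x \<in> {1, -1}" "v x \<in> {1, -1}" for x unfolding u_def v_def o_def by (rule 1)+
  have entry: "block_entry As' x y = u x * v y * block_entry As (P x) (Q y)"
    if xy: "x \<in> block_index As'" "y \<in> block_index As'" for x y
  proof -
    let ?r = "block_pos As' x" and ?c = "block_pos As' y"
    have rc: "?r < dim_row ?D" "?c < dim_row ?D" using block_pos_less xy 1(1) by metis+
    then have pq: "p ?r < dim_row ?D" "q ?c < dim_row ?D"
      using 1(3,4) sqD by (auto dest!: bij_betwE)
    have PQ: "P x \<in> block_index As" "Q y \<in> block_index As"
      using xy P Q by (auto dest!: bij_betwE)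
    have "block_entry As' x y = ?D' $$ (?r, ?c)"
      using diag_block_mat_block_pos[OF sq(2) xy] by simp
    also have "\<dots> = u x * v y * ?D $$ (p ?r, q ?c)"
      using 1(7) rc sqD by (simp add: u_def v_def)
    also have "?D $$ (p ?r, q ?c) = ?D $$ (block_pos As (P x), block_pos As (Q y))"
      using pq by (simp add: P_def Q_def pos_g)
    also have "\<dots> = block_entry As (P x) (Q y)" by (rule diag_block_mat_block_pos[OF sq(1) PQ])
    finally show ?thesis .
  qed
  \<comment> \<open>Signs never vanish, so the pattern of nonzero entries is preserved in both
    directions; everything about blocks is deduced from it.\<close>
  have nz: "block_entry As' x y \<noteq> 0 \<longleftrightarrow> block_entry As (P x) (Q y) \<noteq> 0"
    if "x \<in> block_index As'" "y \<in> block_index As'" for x y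
    using entry[OF that] uv(1)[of x] uv(2)[of y] by auto
  define P' where "P' = inv_into (block_index As') P"
  define Q' where "Q' = inv_into (block_index As') Q"
  have P'_mem: "P' x \<in> block_index As'" and PP': "P (P' x) = x" if "x \<in> block_index As" for x
    unfolding P'_def using that bij_betwE[OF bij_betw_inv_into[OF P]] bij_betw_inv_into_right[OF P]
    by blast+
  have Q'_mem: "Q' x \<in> block_index As'" and QQ': "Q (Q' x) = x" if "x \<in> block_index As" for x
    unfolding Q'_def using that bij_betwE[OF bij_betw_inv_into[OF Q]] bij_betw_inv_into_right[OF Q]
    by blast+
  have P'P: "P' (P x) = x" if "x \<in> block_index As'" for x
    using bij_betw_inv_into_left[OF P that] by (simp add: P'_def)
  have P_mem: "P x \<in> block_index As" and Q_mem: "Q x \<in> block_index As" if "x \<in> block_index As'" for x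
    using that bij_betwE[OF P] bij_betwE[OF Q] by blast+
  have sameP: "fst (P x) = fst (P y)"
    if "x \<in> block_index As'" "y \<in> block_index As'" "fst x = fst y" for x y
    by (rule rows_to_single_block[OF prim(2) _ that, where Bs = As and Q = Q]) (simp add: nz)
  \<comment> \<open>The same argument for the inverse maps: \<open>nz\<close> is applied to the
    preimages of a row and a column.\<close>
  have sameP': "fst (P' x) = fst (P' y)"
    if "x \<in> block_index As" "y \<in> block_index As" "fst x = fst y" for x y
    by (rule rows_to_single_block[OF prim(1) _ that, where Bs = As' and Q = Q'])
      (simp add: nz P'_mem Q'_mem PP' QQ')
  \<comment> \<open>Primitive matrices are nonempty, so row 0 can represent its block.\<close>
  have start: "(i, 0) \<in> block_index As" if "i < length As" for i
    using prim(1) that nth_mem[OF that] by (auto simp: mem_block_index primitive_weighing_def)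
  have start': "(i, 0) \<in> block_index As'" if "i < length As'" for i
    using prim(2) that nth_mem[OF that] by (auto simp: mem_block_index primitive_weighing_def)
  \<comment> \<open>By \<open>sameP'\<close> any other row of block \<open>i\<close> would give the
    same block of \<open>As'\<close>.\<close>
  define f where "f i = fst (P' (i, 0))" for i
  have fP': "fst (P' x) = f (fst x)" if "x \<in> block_index As" for x
    unfolding f_def using that start by (intro sameP') (auto simp: mem_block_index)
  have f_less: "f i < length As'" if "i < length As" for i
    using P'_mem[OF start[OF that]] by (simp add: f_def mem_block_index)
  have fP: "fst (P x) = i" if "x \<in> block_index As'" "fst x = f i" "i < length As" for x i
    using sameP[OF that(1) P'_mem[OF start[OF that(3)]]] PP'[OF start[OF that(3)]] that(2)
    by (simp add: f_def)
  have bij_f: "bij_betw f {..<length As} {..<length As'}"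
  \<comment> \<open>The inverse follows row 0 of a block of \<open>As'\<close> forward under
    \<open>P\<close>.\<close>
  proof (rule bij_betwI[where g = "\<lambda>j. fst (P (j, 0))"])
    show "f \<in> {..<length As} \<rightarrow> {..<length As'}" using f_less by auto
    show "(\<lambda>j. fst (P (j, 0))) \<in> {..<length As'} \<rightarrow> {..<length As}"
      using P_mem start' by (auto simp: mem_block_index)
    show "fst (P (f i, 0)) = i" if "i \<in> {..<length As}" for i
      using fP[of "(f i, 0)" i] start' f_less that by auto
    show "f (fst (P (j, 0))) = j" if "j \<in> {..<length As'}" for j
      using fP'[OF P_mem[OF start'], of j] P'P[OF start', of j] that by auto
  qed
  then have len: "length As = length As'" using bij_betw_same_card by fastforce
  have block: "As ! i \<sim>\<^sub>H As' ! f i" if i: "i < length As" for i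
  proof -
    let ?A = "As ! i" and ?B = "As' ! f i"
    have pA: "primitive_weighing ?A" and pB: "primitive_weighing ?B"
      using prim i f_less[OF i] by auto
    note sqA = primitive_weighing_square[OF pA] and sqB = primitive_weighing_square[OF pB]
    have memB: "(f i, a) \<in> block_index As' \<longleftrightarrow> a < dim_row ?B" for a
      using f_less[OF i] by (simp add: mem_block_index)
    have memA: "(i, a) \<in> block_index As \<longleftrightarrow> a < dim_row ?A" for a
      using i by (simp add: mem_block_index)
    \<comment> \<open>Rows of block \<open>f i\<close> are known to land in block \<open>i\<close>;
      for columns this is still open and can fail for zero blocks.\<close>
    define p0 where "p0 a = snd (P (f i, a))" for a
    define q0 where "q0 a = snd (Q (f i, a))" for a
    have Pp0: "P (f i, a) = (i, p0 a)" if "a < dim_row ?B" for a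
      using fP[of "(f i, a)" i] i that memB by (simp add: p0_def prod_eq_iff)
    have p0: "bij_betw p0 {..<dim_row ?B} {..<dim_row ?A}"
    proof (rule bij_betwI[where g = "\<lambda>a. snd (P' (i, a))"])
      have P'f: "P' (i, a) = (f i, snd (P' (i, a)))" if "a < dim_row ?A" for a
        using fP'[of "(i, a)"] that memA by (simp add: prod_eq_iff)
      show "p0 \<in> {..<dim_row ?B} \<rightarrow> {..<dim_row ?A}"
      proof
        fix a assume "a \<in> {..<dim_row ?B}"
        then show "p0 a \<in> {..<dim_row ?A}"
          using P_mem[of "(f i, a)"] Pp0[of a] memA[of "p0 a"] memB[of a] by simp
      qed
      show "(\<lambda>a. snd (P' (i, a))) \<in> {..<dim_row ?A} \<rightarrow> {..<dim_row ?B}"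
      proof
        fix a assume "a \<in> {..<dim_row ?A}"
        then show "snd (P' (i, a)) \<in> {..<dim_row ?B}"
          using P'_mem[of "(i, a)"] fP'[of "(i, a)"] memA[of a] by (simp add: mem_block_index)
      qed
      show "snd (P' (i, p0 a)) = a" if "a \<in> {..<dim_row ?B}" for a
        using P'P[of "(f i, a)"] Pp0[of a] memB that by auto
      show "p0 (snd (P' (i, a))) = a" if "a \<in> {..<dim_row ?A}" for a
        using PP'[of "(i, a)"] P'f[of a] memA that by (auto simp: p0_def)
    qed
    have dims: "dim_row ?B = dim_row ?A" using bij_betw_same_card[OF p0] by simp
    show ?thesis
    \<comment> \<open>A zero block gives no control over \<open>Q\<close>, because zero columns can
      be permuted independently of zero rows. Its size is 1, so comparing one entry
      suffices.\<close>
    proof (cases "?B = 0\<^sub>m (dim_row ?B) (dim_row ?B)")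
      case True
      then have B1: "dim_row ?B = 1" using primitive_weighing_zero pB by metis
      have "p0 0 = 0" using bspec[OF bij_betwE[OF p0], of 0] dims B1 by simp
      then have P0: "P (f i, 0) = (i, 0)" using Pp0[of 0] B1 by simp
      \<comment> \<open>Otherwise the column that \<open>Q\<close> sends to \<open>(i, 0)\<close>
        meets row \<open>(f i, 0)\<close> in a nonzero entry. It then belongs to block
        \<open>f i\<close>, whose only entry is 0.\<close>
      have "?A $$ (0,0) = 0"
      proof (rule ccontr)
        assume "?A $$ (0,0) \<noteq> 0"
        moreover have A0: "(i, 0) \<in> block_index As" and B0: "(f i, 0) \<in> block_index As'"
          using memA memB B1 dims by auto
        ultimately have y: "block_entry As' (f i, 0) (Q' (i, 0)) \<noteq> 0"
          using nz[OF B0 Q'_mem[OF A0]] QQ'[OF A0] P0 by (simp add: block_entry_def)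
        then have "fst (Q' (i, 0)) = f i" by (auto simp: block_entry_def split: if_splits)
        moreover from this have "snd (Q' (i, 0)) < dim_row ?B"
          using Q'_mem[OF A0] by (simp add: mem_block_index)
        ultimately have "?B $$ (0,0) \<noteq> 0" using y B1 by (simp add: block_entry_def)
        moreover have "?B $$ (0,0) = 0" by (subst True) (simp add: B1)
        ultimately show False by simp
      qed
      then have "?A = 0\<^sub>m (dim_row ?B) (dim_row ?B)"
        using sqA dims B1 by (intro eq_matI) (simp_all only: index_zero_mat less_one)
      then have "?A = ?B" using True by argo
      then show ?thesis using H_equiv_refl by simp
    next
      case False
      \<comment> \<open>A nonzero entry of column \<open>c\<close> lies in a row whose image is in
        block \<open>i\<close>, which drags the image of the column into block
        \<open>i\<close>.\<close>
      have Qq0: "Q (f i, c) = (i, q0 c)" if c: "c < dim_row ?B" for c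
      proof -
        obtain r where r: "r < dim_row ?B" "?B $$ (r,c) \<noteq> 0"
          using primitive_weighing_column_nonzero[OF pB False c] by blast
        then have "block_entry As (P (f i, r)) (Q (f i, c)) \<noteq> 0"
          using nz[of "(f i, r)" "(f i, c)"] memB c by (simp add: block_entry_def)
        then have "fst (Q (f i, c)) = i"
          using Pp0[OF r(1)] by (auto simp: block_entry_def split: if_splits)
        then show ?thesis by (simp add: q0_def prod_eq_iff)
      qed
      \<comment> \<open>The bijection \<open>p0\<close> has already equated the two sizes, so
        \<open>q0\<close> is an injective self-map of a finite set once injectivity is inherited
        from \<open>Q\<close>.\<close>
      have "q0 ` {..<dim_row ?B} \<subseteq> {..<dim_row ?B}"
      proof (rule image_subsetI)
        fix a assume "a \<in> {..<dim_row ?B}"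
        then show "q0 a \<in> {..<dim_row ?B}"
          using Q_mem[of "(f i, a)"] Qq0[of a] memA[of "q0 a"] memB[of a] dims by simp
      qed
      moreover have "inj_on q0 {..<dim_row ?B}"
      proof (rule inj_onI)
        fix a b assume ab: "a \<in> {..<dim_row ?B}" "b \<in> {..<dim_row ?B}" "q0 a = q0 b"
        then have "Q (f i, a) = Q (f i, b)" using Qq0 by simp
        then have "(f i, a) = (f i, b)"
          by (rule inj_onD[OF bij_betw_imp_inj_on[OF Q]]) (use memB ab in simp_all)
        then show "a = b" by simp
      qed
      ultimately have q0: "bij_betw q0 {..<dim_row ?A} {..<dim_row ?A}"
        unfolding bij_betw_def using endo_inj_surj[of "{..<dim_row ?B}" q0] dims by simp
      show ?thesis
      proof (rule H_equivI[where p = p0 and q = q0 and s = "\<lambda>a. u (f i, a)" and t = "\<lambda>a. v (f i, a)"])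
        fix a b assume "a < dim_row ?A" "b < dim_col ?A"
        then have ab: "a < dim_row ?B" "b < dim_row ?B" using dims sqA by auto
        show "?B $$ (a,b) = u (f i, a) * v (f i, b) * ?A $$ (p0 a, q0 b)"
          using entry[of "(f i, a)" "(f i, b)"] ab Pp0 Qq0 memB by (simp add: block_entry_def)
      qed (use dims sqA sqB p0 q0 uv in simp_all)
    qed
  qed
  \<comment> \<open>\<open>permutes\<close> demands the identity outside the index set, which
    \<open>f\<close> need not satisfy.\<close>
  define \<pi> where "\<pi> i = (if i < length As then f i else i)" for i
  have "bij_betw \<pi> {..<length As} {..<length As}"
    using bij_f len by (subst bij_betw_cong[of _ _ f]) (auto simp: \<pi>_def)
  then have "\<pi> permutes {..<length As}" by (rule bij_imp_permutes) (simp add: \<pi>_def)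
  moreover have "\<forall>i<length As. As ! i \<sim>\<^sub>H As' ! \<pi> i" using block by (simp add: \<pi>_def)
  ultimately show ?thesis using len by blast
qed

theorem theorem4p6:
  shows "(\<forall>A. integer_weighing A \<longrightarrow>
            (\<exists>As. (\<forall>B \<in> set As. primitive_weighing B) \<and> A \<sim>\<^sub>H diag_block_mat As)) \<and>
         (\<forall>As As'. (\<forall>B \<in> set As. primitive_weighing B) \<longrightarrow>
            (\<forall>B \<in> set As'. primitive_weighing B) \<longrightarrow>
            diag_block_mat As \<sim>\<^sub>H diag_block_mat As' \<longrightarrow>
            length As = length As' \<and>
            (\<exists>\<pi>. \<pi> permutes {..<length As} \<and>
                 (\<forall>i<length As. As ! i \<sim>\<^sub>H As' ! \<pi> i)))"
  using primitive_decomposition_exists primitive_decomposition_unique by blast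

end
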